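(* Let $m>1$ be an integer. Then $$a(2m)\ \ge\ \omega(m)-\begin{cases}1 & \text{if } m\equiv 2 \pmod 4,\\ 0 & \text{otherwise.}\end{cases}$$ Moreover, if the Goldbach conjecture is true (every even integer $N>4$ is a sum of two odd primes), then $$a(2m)\ \ge\ d(m)-\begin{cases}2 & \text{if } m \text{ is even},\\ 1 & \text{otherwise.}\end{cases}$$
   Context: $\mathcal P$ is the set of odd primes and $\chi_{\mathcal P}:\mathbb N\to\{0,1\}$ its indicator function. For a positive integer $N$, $R(N)=\sum_{n=1}^{N-1}\chi_{\mathcal P}(n)\chi_{\mathcal P}(N-n)$, and $F_N(z)=\sum_{k=0}^{N-1}\left(\sum_{n=1}^{N-1}\chi_{\mathcal P}(n)z^{kn}\right)^2=\sum_{m=0}^{2(N-1)^2}a_{N,m}z^m$. For $0<m\le N$ one has $a_{N,m}=\sum_{d\mid m}R(d)$, independent of $N$; this common value is denoted $a(m)$, so for every positive integer $m$, $a(m)=\sum_{d\mid m}R(d)$ (sum over positive divisors). $\omega(m)$ is the number of distinct prime factors of $m$, and $d(m)$ is the number of positive divisors of $m$. *)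

theory Defs
  imports "HOL-Computational_Algebra.Computational_Algebra" "HOL-Library.Indicator_Function"
begin

definition odd_primes :: "nat set" where
  "odd_primes = {p. prime p \<and> odd p}"

definition goldbach_R :: "nat \<Rightarrow> int" where
  "goldbach_R N = (\<Sum>n=1..N-1. indicator odd_primes n * indicator odd_primes (N - n))"

definition goldbach_F :: "nat \<Rightarrow> int poly" where
  "goldbach_F N = (\<Sum>k=0..N-1. (\<Sum>n=1..N-1. monom (indicator odd_primes n) (k * n))\<^sup>2)"

definition goldbach_coeff :: "nat \<Rightarrow> nat \<Rightarrow> int" where
  "goldbach_coeff N m = coeff (goldbach_F N) m"

text \<open>For \<open>0 < m \<le> N\<close> the coefficient \<open>goldbach_coeff N m\<close> does not depend on \<open>N\<close>
  (lemmas \<open>goldbach_coeff_eq_a\<close> and \<open>goldbach_a_eq_sum_R\<close> below), so its value at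
  \<open>N = m\<close> is the common value.\<close>

definition goldbach_a :: "nat \<Rightarrow> int" where
  "goldbach_a m = goldbach_coeff m m"

definition omega :: "nat \<Rightarrow> nat" where
  "omega m = card (prime_factors m)"

definition num_divisors :: "nat \<Rightarrow> nat" where
  "num_divisors m = card {d. d dvd m}"

definition goldbach_conjecture :: bool where
  "goldbach_conjecture \<longleftrightarrow>
     (\<forall>N::nat. even N \<and> N > 4 \<longrightarrow> (\<exists>p\<in>odd_primes. \<exists>q\<in>odd_primes. N = p + q))"

lemma coeff_F_inner:
  "coeff ((\<Sum>n=1..M. monom (indicator odd_primes n :: int) (k * n))\<^sup>2) m =
     (\<Sum>i=1..M. \<Sum>j=1..M. if k * (i + j) = m
        then indicator odd_primes i * indicator odd_primes j else 0)"
  by (simp add: power2_eq_square sum_product coeff_sum mult_monom distrib_left)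

lemma R_eq_double_sum:
  assumes "d \<le> Suc M"
  shows "goldbach_R d = (\<Sum>i=1..M. \<Sum>j=1..M. if i + j = d
        then indicator odd_primes i * indicator odd_primes j else 0)"
proof -
  have inner: "(\<Sum>j=1..M. if i + j = d then indicator odd_primes i * indicator odd_primes j else 0)
     = (if i < d then indicator odd_primes i * indicator odd_primes (d - i) else (0::int))"
    if "i \<in> {1..M}" for i
  proof (cases "i < d")
    case True
    have "(\<Sum>j=1..M. if i + j = d then indicator odd_primes i * indicator odd_primes j else 0)
      = (\<Sum>j=1..M. if j = d - i then indicator odd_primes i * indicator odd_primes j else (0::int))"
      using True by (intro sum.cong) auto
    also have "\<dots> = indicator odd_primes i * indicator odd_primes (d - i)"
      using True that assms by (subst sum.delta) auto
    finally show ?thesis using True by simp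
  next
    case False
    then show ?thesis by (intro trans[OF sum.neutral]) auto
  qed
  have "(\<Sum>i=1..M. \<Sum>j=1..M. if i + j = d
        then indicator odd_primes i * indicator odd_primes j else 0)
     = (\<Sum>i=1..M. if i < d then indicator odd_primes i * indicator odd_primes (d - i) else (0::int))"
    by (rule sum.cong[OF refl inner])
  also have "\<dots> = (\<Sum>i=1..d-1. indicator odd_primes i * indicator odd_primes (d - i))"
    using assms by (intro sum.mono_neutral_cong_right) auto
  finally show ?thesis unfolding goldbach_R_def by simp
qed

lemma goldbach_coeff_eq_sum_R:
  assumes "0 < m" "m \<le> N"
  shows "goldbach_coeff N m = (\<Sum>d | d dvd m. goldbach_R d)"
proof -
  have R1: "goldbach_R 1 = 0" by (simp add: goldbach_R_def)
  have inner: "coeff ((\<Sum>n=1..N-1. monom (indicator odd_primes n :: int) (k * n))\<^sup>2) m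
      = (if k dvd m then goldbach_R (m div k) else 0)" for k
  proof (cases "k dvd m")
    case True
    with assms have k: "k > 0" by (auto intro: Nat.gr0I)
    have eq: "k * (i + j) = m \<longleftrightarrow> i + j = m div k" for i j
      using True k by auto
    have "m div k \<le> m" by simp
    then have "m div k \<le> Suc (N - 1)" using assms by linarith
    from R_eq_double_sum[OF this] show ?thesis
      using True by (simp only: coeff_F_inner eq if_True)
  next
    case False
    then have "k * (i + j) \<noteq> m" for i j by (metis dvd_triv_left)
    with False show ?thesis by (simp only: coeff_F_inner if_False sum.neutral_const)
  qed
  have "goldbach_coeff N m = (\<Sum>k=0..N-1. if k dvd m then goldbach_R (m div k) else 0)"
    by (simp only: goldbach_coeff_def goldbach_F_def coeff_sum inner)
  also have "\<dots> = (\<Sum>k | k dvd m. goldbach_R (m div k))"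
  proof (rule sum.mono_neutral_cong)
    show "finite {k. k dvd m}" using assms by simp
    show "goldbach_R (m div i) = 0" if "i \<in> {k. k dvd m} - {0..N-1}" for i
    proof -
      from that have "i dvd m" "i > N - 1" by auto
      moreover from this assms have "i \<le> m" by (auto dest: dvd_imp_le)
      ultimately have "i = m" using assms by linarith
      with assms R1 show ?thesis by simp
    qed
  qed auto
  also have "\<dots> = (\<Sum>d | d dvd m. goldbach_R d)"
    by (rule sum.reindex_bij_witness[of _ "\<lambda>d. m div d" "\<lambda>d. m div d"])
       (use assms in \<open>auto elim!: dvdE\<close>)
  finally show ?thesis .
qed

lemma goldbach_a_eq_sum_R: "0 < m \<Longrightarrow> goldbach_a m = (\<Sum>d | d dvd m. goldbach_R d)"
  by (simp add: goldbach_a_def goldbach_coeff_eq_sum_R)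

lemma goldbach_coeff_eq_a: "0 < m \<Longrightarrow> m \<le> N \<Longrightarrow> goldbach_coeff N m = goldbach_a m"
  by (simp add: goldbach_a_eq_sum_R goldbach_coeff_eq_sum_R)

end

theory Submission
  imports Defs
begin

lemma goldbach_R_nonneg: "goldbach_R N \<ge> 0"
  unfolding goldbach_R_def by (intro sum_nonneg) (simp add: indicator_def)

text \<open>The summand at \<open>n = p\<close> equals 1, and all other summands are
  nonnegative.\<close>

lemma goldbach_R_sum_pos:
  assumes "p \<in> odd_primes" "q \<in> odd_primes"
  shows "goldbach_R (p + q) \<ge> 1"
proof -
  have "p > 0" "q > 0"
    using assms by (auto simp: odd_primes_def prime_gt_0_nat)
  then have "indicator odd_primes p * indicator odd_primes (p + q - p) \<le> goldbach_R (p + q)"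
    unfolding goldbach_R_def
    by (intro member_le_sum) (auto simp: indicator_def)
  then show ?thesis using assms by simp
qed

text \<open>Distinct \<open>d\<close> in \<open>S\<close> give distinct divisors
  \<open>2 * d\<close> of \<open>2 * m\<close>, each contributing at least 1 to the divisor sum for
  \<open>goldbach_a (2 * m)\<close>; the remaining terms are nonnegative. Both bounds thus reduce to
  choosing a large set \<open>S\<close>.\<close>

lemma goldbach_a_double_ge_card:
  assumes "m > 0" and dvd: "\<And>d. d \<in> S \<Longrightarrow> d dvd m"
    and pos: "\<And>d. d \<in> S \<Longrightarrow> goldbach_R (2 * d) \<ge> 1"
  shows "goldbach_a (2 * m) \<ge> int (card S)"
proof -
  have "int (card S) = (\<Sum>d\<in>S. 1)" by simp
  also have "\<dots> \<le> (\<Sum>d\<in>S. goldbach_R (2 * d))"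
    using pos by (rule sum_mono)
  also have "\<dots> = (\<Sum>d\<in>(*) 2 ` S. goldbach_R d)"
    by (simp add: sum.reindex inj_on_def)
  also have "\<dots> \<le> (\<Sum>d | d dvd 2 * m. goldbach_R d)"
    using assms(1) dvd by (intro sum_mono2) (auto simp: goldbach_R_nonneg)
  finally show ?thesis using assms(1) by (simp add: goldbach_a_eq_sum_R)
qed

lemma goldbach_a_double_ge_omega:
  assumes "m > 0"
  shows "goldbach_a (2 * m) \<ge> int (omega m) - (if m mod 4 = 2 then 1 else 0)"
proof -
  \<comment> \<open>If \<open>m mod 4 = 2\<close>, then 4 does not divide \<open>m\<close> and
    cannot stand in for the prime 2, so 2 is dropped; this costs the 1.\<close>
  define P where "P = prime_factors m - (if m mod 4 = 2 then {2} else {})"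
  \<comment> \<open>The divisor \<open>2 * 2\<close> of \<open>2 * m\<close> is not a sum of two odd primes, so the prime 2 is
    counted through \<open>2 * 4 = 3 + 5\<close>, which divides \<open>2 * m\<close> when \<open>4 dvd m\<close>.\<close>
  define g :: "nat \<Rightarrow> nat" where "g p = (if p = 2 then 4 else p)" for p
  have P: "prime p" "p dvd m" if "p \<in> P" for p
    using that by (auto simp: P_def)
  \<comment> \<open>The value \<open>g 2 = 4\<close> could only collide with \<open>g 4\<close>, so
    injectivity of \<open>g\<close> needs that 4 is not prime.\<close>
  have not4: "4 \<notin> P"
  proof
    assume "4 \<in> P"
    then have "prime (2 * 2 :: nat)" using P(1) by fastforce
    then show False using prime_product by force
  qed
  have "inj_on g P" using not4 by (auto simp: inj_on_def g_def)
  then have "card (g ` P) = card P" by (rule card_image)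
  moreover have "goldbach_a (2 * m) \<ge> int (card (g ` P))"
  proof (rule goldbach_a_double_ge_card[OF assms])
    fix d assume "d \<in> g ` P"
    then obtain p where p: "p \<in> P" "d = g p" by blast
    show "d dvd m"
    proof (cases "p = 2")
      case True
      with p have "m mod 4 \<noteq> 2" by (auto simp: P_def)
      moreover from True p P have "even m" by blast
      ultimately have "4 dvd m" by presburger
      with True p show ?thesis by (simp add: g_def)
    qed (use p P in \<open>auto simp: g_def\<close>)
    show "goldbach_R (2 * d) \<ge> 1"
    proof (cases "p = 2")
      case True
      have "prime (3::nat)" "prime (5::nat)" by simp_all
      then have "3 \<in> odd_primes" "5 \<in> odd_primes" by (simp_all add: odd_primes_def)
      from goldbach_R_sum_pos[OF this] True p show ?thesis by (simp add: g_def)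
    next
      case False
      \<comment> \<open>An odd prime is its own partner: \<open>2 * p = p + p\<close>.\<close>
      with p P have "p \<in> odd_primes"
        by (metis mem_Collect_eq odd_primes_def primes_dvd_imp_eq two_is_prime_nat)
      from goldbach_R_sum_pos[OF this this] False p show ?thesis
        by (simp add: g_def mult_2)
    qed
  qed
  moreover have "int (omega m) \<le> int (card P) + (if m mod 4 = 2 then 1 else 0)"
  proof -
    have "card (prime_factors m) \<le> card (prime_factors m - {2}) + 1"
      using diff_card_le_card_Diff[of "{2}" "prime_factors m"] by simp
    then show ?thesis by (auto simp: omega_def P_def)
  qed
  ultimately show ?thesis by linarith
qed

text \<open>For every divisor \<open>d > 2\<close> of \<open>m\<close>, the number
  \<open>2 * d\<close> is even and exceeds 4, so the conjecture applies. Only the divisors in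
  \<open>E\<close>, those at most 2, are lost.\<close>

lemma goldbach_a_double_ge_num_divisors:
  assumes "m > 0" goldbach_conjecture
  shows "goldbach_a (2 * m) \<ge> int (num_divisors m) - (if even m then 2 else 1)"
proof -
  define E :: "nat set" where "E = (if even m then {1, 2} else {1})"
  have "goldbach_a (2 * m) \<ge> int (card ({d. d dvd m} - E))"
  proof (rule goldbach_a_double_ge_card[OF assms(1)])
    fix d assume d: "d \<in> {d. d dvd m} - E"
    then show "d dvd m" by simp
    \<comment> \<open>Here 0 is excluded because \<open>m > 0\<close>, and 2 either by
      \<open>E\<close> or, for odd \<open>m\<close>, because it does not divide
      \<open>m\<close>.\<close>
    have "d \<noteq> 0" "d \<noteq> 1" "d \<noteq> 2"
      using d assms(1) by (auto simp: E_def split: if_splits)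
    then have "even (2 * d) \<and> 2 * d > 4" by simp
    with assms(2) obtain p q where "p \<in> odd_primes" "q \<in> odd_primes" "2 * d = p + q"
      unfolding goldbach_conjecture_def by blast
    then show "goldbach_R (2 * d) \<ge> 1" by (simp add: goldbach_R_sum_pos)
  qed
  \<comment> \<open>The truncated difference of naturals is at least the integer one, so the bound
    transfers to \<open>int\<close>.\<close>
  moreover have "card ({d. d dvd m} - E) \<ge> num_divisors m - card E"
    unfolding num_divisors_def by (rule diff_card_le_card_Diff) (simp add: E_def)
  moreover have "int (card E) = (if even m then 2 else 1)"
    by (simp add: E_def)
  ultimately show ?thesis by linarith
qed

theorem theorem3p2:
  fixes m :: nat
  assumes "m > 1"
  shows "goldbach_a (2 * m) \<ge> int (omega m) - (if m mod 4 = 2 then 1 else 0) \<and>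
         (goldbach_conjecture \<longrightarrow>
            goldbach_a (2 * m) \<ge> int (num_divisors m) - (if even m then 2 else 1))"
  using assms goldbach_a_double_ge_omega goldbach_a_double_ge_num_divisors by simp

end
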